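(* Let $\varepsilon>0$, let $(u^n,\xi^n)$ be an admissible single-interface state with majorant parameter $\alpha>0$, and let $(u^{n+1},\xi^{n+1})$ be the result of one iteration step of the scheme applied to $(u^n,\xi^n)$. Then $$u^{n+1}(x)\le 2+\alpha\,(x-\xi^{n+1})\qquad\text{for all } x>\xi^{n+1}.$$
   Context: Kernels: for $\varepsilon>0$ let $g_\varepsilon(x)=\frac{1}{2\varepsilon}\exp(-|x|/\varepsilon)$, and let $s_\varepsilon(x)=-\exp(x/\varepsilon)$ for $x\le0$, $s_\varepsilon(x)=+\exp(-x/\varepsilon)$ for $x>0$ (so $s_\varepsilon=\mathrm{sgn}-g_\varepsilon\ast\mathrm{sgn}$). Iteration step of the scheme: given $(u^n,\xi^n)$ with $u^n:\mathbb{R}\to\mathbb{R}$, $\xi^n\in\mathbb{R}$: 1. Set $\tilde u^n:=g_\varepsilon\ast u^n$. 2. Update of $\xi^n$: (LM) if $\tilde u^n(\xi^n)>1$, choose the maximal value of $\xi^{n+1}$ with $\xi^{n+1}<\xi^n$ and $\tilde u^n(\xi^{n+1})=+1$; (RM) if $\tilde u^n(\xi^n)<-1$, choose the minimal value of $\xi^{n+1}$ with $\xi^{n+1}>\xi^n$ and $\tilde u^n(\xi^{n+1})=-1$; (ST) if $\tilde u^n(\xi^n)\in[-1,1]$, set $\xi^{n+1}=\xi^n$. 3. Set $u^{n+1}=\tilde u^n+s_\varepsilon(\cdot-\xi^{n+1})$. For admissible $(u^n,\xi^n)$ this step is well-defined. Admissible single-interface state with majorant parameter $\alpha$: a pair $(u^n,\xi^n)$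 such that (i) $u^n$ is continuous for $x<\xi^n$ and for $x>\xi^n$; (ii) the jump $\lim_{x\searrow\xi^n}u^n(x)-\lim_{x\nearrow\xi^n}u^n(x)$ equals $2$; (iii) $-2\le u^n(x)\le0$ for $x\le\xi^n$ and $u^n(x)\ge0$ for $x>\xi^n$; (iv) $\alpha>0$ and $u^n(x)\le\alpha(x-\xi^n)+2$ for all $x>\xi^n$. *)

theory Defs
  imports "HOL-Analysis.Analysis"
begin

definition kernel_g :: "real \<Rightarrow> real \<Rightarrow> real" where
  "kernel_g \<epsilon> x = 1 / (2 * \<epsilon>) * exp (- \<bar>x\<bar> / \<epsilon>)"

definition kernel_s :: "real \<Rightarrow> real \<Rightarrow> real" where
  "kernel_s \<epsilon> x = (if x \<le> 0 then - exp (x / \<epsilon>) else exp (- x / \<epsilon>))"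

text \<open>The Bochner integral is 0 for non-integrable integrands. This default is never
  reached in convolving \<^term>\<open>kernel_g \<epsilon>\<close> (for \<epsilon> > 0) with the first component of an
  admissible state, which is Borel measurable and grows at most linearly.\<close>

definition convolution :: "(real \<Rightarrow> real) \<Rightarrow> (real \<Rightarrow> real) \<Rightarrow> real \<Rightarrow> real" where
  "convolution f h x = (LINT y|lborel. f (x - y) * h y)"

text \<open>The value of \<open>u\<close> at the interface \<open>\<xi>\<close> itself is only constrained by the bounds
  \<open>- 2 \<le> u \<xi> \<le> 0\<close>; the jump concerns the one-sided limits, which are required to exist.\<close>

definition admissible :: "real \<Rightarrow> (real \<Rightarrow> real) \<Rightarrow> real \<Rightarrow> bool" where
  "admissible \<alpha> u \<xi> \<longleftrightarrow>
     continuous_on {..<\<xi>} u \<and> continuous_on {\<xi><..} u \<and>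
     (\<exists>l r. (u \<longlongrightarrow> l) (at_left \<xi>) \<and> (u \<longlongrightarrow> r) (at_right \<xi>) \<and> r - l = 2) \<and>
     (\<forall>x\<le>\<xi>. - 2 \<le> u x \<and> u x \<le> 0) \<and> (\<forall>x>\<xi>. 0 \<le> u x) \<and>
     \<alpha> > 0 \<and> (\<forall>x>\<xi>. u x \<le> \<alpha> * (x - \<xi>) + 2)"

text \<open>The interface update, as a relation between the smoothed function \<open>v\<close>, the old
  interface \<open>\<xi>\<close> and the new interface \<open>\<xi>'\<close>; the maximum and minimum determine \<open>\<xi>'\<close> uniquely.\<close>

definition interface_update :: "(real \<Rightarrow> real) \<Rightarrow> real \<Rightarrow> real \<Rightarrow> bool" where
  "interface_update v \<xi> \<xi>' \<longleftrightarrow>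
     (v \<xi> > 1 \<longrightarrow> \<xi>' < \<xi> \<and> v \<xi>' = 1 \<and> (\<forall>y. y < \<xi> \<and> v y = 1 \<longrightarrow> y \<le> \<xi>')) \<and>
     (v \<xi> < - 1 \<longrightarrow> \<xi> < \<xi>' \<and> v \<xi>' = - 1 \<and> (\<forall>y. \<xi> < y \<and> v y = - 1 \<longrightarrow> \<xi>' \<le> y)) \<and>
     (v \<xi> \<in> {- 1..1} \<longrightarrow> \<xi>' = \<xi>)"

definition scheme_step ::
    "real \<Rightarrow> (real \<Rightarrow> real) \<times> real \<Rightarrow> (real \<Rightarrow> real) \<times> real \<Rightarrow> bool" where
  "scheme_step \<epsilon> = (\<lambda>(u, \<xi>) (u', \<xi>').
     let v = convolution (kernel_g \<epsilon>) u in
       interface_update v \<xi> \<xi>' \<and> u' = (\<lambda>x. v x + kernel_s \<epsilon> (x - \<xi>')))"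

end

theory Submission
  imports "HOL-Probability.Sinc_Integral" Defs
begin

text \<open>Put \<open>v = g\<^sub>\<epsilon> * u\<close>. For \<open>x > \<xi>'\<close> the kernel
  \<open>K y = g\<^sub>\<epsilon> (x - y) - exp (- (x - \<xi>') / \<epsilon>) g\<^sub>\<epsilon> (\<xi>' - y)\<close> vanishes for \<open>y \<le> \<xi>'\<close> and is
  nonnegative for \<open>y > \<xi>'\<close>, so in \<open>v x - exp (- (x - \<xi>') / \<epsilon>) v \<xi>' = \<integral> K u\<close> only the values of \<open>u\<close>
  to the right of \<open>\<xi>'\<close> matter. There \<open>u\<close> lies below the affine function \<open>2 + \<alpha> (y - \<xi>')\<close>, since
  \<open>\<xi>' \<le> \<xi>\<close> (the lower bound on \<open>u\<close> excludes a move to the right), and convolution with \<open>g\<^sub>\<epsilon>\<close>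
  reproduces affine functions. Together with \<open>v \<xi>' \<le> 1\<close> this is exactly the claim.\<close>

lemma kernel_g_nonneg: "\<epsilon> > 0 \<Longrightarrow> 0 \<le> kernel_g \<epsilon> x"
  by (simp add: kernel_g_def)

lemma kernel_g_measurable [measurable]: "kernel_g \<epsilon> \<in> borel_measurable borel"
  unfolding kernel_g_def by measurable

text \<open>Rescaling by t = (y - x) / \<epsilon> reduces the integral to the moments of exp (-
  \<bar>t\<bar>) of order 0 and 1; the first moment is zero by oddness, so only the value of the
  affine function at \<open>x\<close> survives.\<close>

lemma has_bochner_integral_kernel_g_affine:
  fixes \<epsilon> a b c x :: real
  assumes "\<epsilon> > 0"
  shows "has_bochner_integral lborel (\<lambda>y. kernel_g \<epsilon> (x - y) * (a + b * (y - c))) (a + b * (x - c))"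
proof -
  have "has_bochner_integral lborel (\<lambda>t::real. indicator {0..} t *\<^sub>R exp (- \<bar>t\<bar>)) 1"
    using has_bochner_integral_I0i_power_exp_m'[of 0]
    by (rule has_bochner_integral_cong[THEN iffD1, rotated -1]) (auto split: split_indicator)
  from has_bochner_integral_even_function[OF this]
  have I0: "has_bochner_integral lborel (\<lambda>t::real. exp (- \<bar>t\<bar>)) 2"
    by simp
  have "has_bochner_integral lborel (\<lambda>t::real. indicator {0..} t *\<^sub>R (t * exp (- \<bar>t\<bar>))) 1"
    using has_bochner_integral_I0i_power_exp_m'[of 1]
    by (rule has_bochner_integral_cong[THEN iffD1, rotated -1]) (auto split: split_indicator)
  then have I1: "has_bochner_integral lborel (\<lambda>t::real. t * exp (- \<bar>t\<bar>)) 0"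
    by (rule has_bochner_integral_odd_function) simp
  \<comment> \<open>The integrand in the variable t: for y = x + \<epsilon> t one has a + b (y - c)
    = (a + b (x - c)) + b \<epsilon> t, and the factor 1 / (2 \<epsilon>) of the kernel turns b
    \<epsilon> into b / 2.\<close>
  let ?f = "\<lambda>t. (a + b * (x - c)) / (2 * \<epsilon>) * exp (- \<bar>t\<bar>) + b / 2 * (t * exp (- \<bar>t\<bar>))"
  have "has_bochner_integral lborel ?f ((a + b * (x - c)) / (2 * \<epsilon>) * 2 + b / 2 * 0)"
    using I0 I1 by (intro has_bochner_integral_add has_bochner_integral_mult_right)
  then have "has_bochner_integral lborel (\<lambda>y. ?f (- x / \<epsilon> + 1 / \<epsilon> * y))
      (((a + b * (x - c)) / (2 * \<epsilon>) * 2 + b / 2 * 0) /\<^sub>R \<bar>1 / \<epsilon>\<bar>)"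
    using assms by (intro lborel_has_bochner_integral_real_affine_iff[THEN iffD1]) auto
  moreover have "?f (- x / \<epsilon> + 1 / \<epsilon> * y) = kernel_g \<epsilon> (x - y) * (a + b * (y - c))" for y
  proof -
    have t: "- x / \<epsilon> + 1 / \<epsilon> * y = (y - x) / \<epsilon>"
      by (simp add: diff_divide_distrib)
    have "\<bar>(y - x) / \<epsilon>\<bar> = \<bar>x - y\<bar> / \<epsilon>"
      using assms by (simp add: abs_minus_commute)
    then show ?thesis
      unfolding t kernel_g_def using assms by (simp add: field_simps)
  qed
  moreover have "((a + b * (x - c)) / (2 * \<epsilon>) * 2 + b / 2 * 0) /\<^sub>R \<bar>1 / \<epsilon>\<bar> = a + b * (x - c)"
    using assms by simp
  ultimately show ?thesis
    by (simp only:)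
qed

text \<open>The substitution t = (x - y) / \<epsilon> maps the half-line left of \<open>x\<close> to
  t \<ge> 0, where the Gamma integral of order 0 applies. This is the mass against which the lower
  bound -2 of \<open>u\<close> is tested.\<close>

lemma has_bochner_integral_kernel_g_left_half:
  fixes \<epsilon> x :: real
  assumes "\<epsilon> > 0"
  shows "has_bochner_integral lborel (\<lambda>y. kernel_g \<epsilon> (x - y) * indicator {..x} y) (1 / 2)"
proof -
  let ?f = "\<lambda>t::real. 1 / (2 * \<epsilon>) * (t ^ 0 * exp (- t) * indicator {0..} t)"
  have "has_bochner_integral lborel ?f (1 / (2 * \<epsilon>) * fact 0)"
    by (intro has_bochner_integral_mult_right has_bochner_integral_I0i_power_exp_m')
  then have "has_bochner_integral lborel (\<lambda>y. ?f (x / \<epsilon> + (- 1 / \<epsilon>) * y))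
      ((1 / (2 * \<epsilon>) * fact 0) /\<^sub>R \<bar>- 1 / \<epsilon>\<bar>)"
    using assms by (intro lborel_has_bochner_integral_real_affine_iff[THEN iffD1]) auto
  moreover have "?f (x / \<epsilon> + (- 1 / \<epsilon>) * y) = kernel_g \<epsilon> (x - y) * indicator {..x} y" for y
  proof -
    have t: "x / \<epsilon> + (- 1 / \<epsilon>) * y = (x - y) / \<epsilon>"
      by (simp add: diff_divide_distrib)
    show ?thesis
      unfolding t kernel_g_def using assms
      by (auto simp: zero_le_divide_iff split: split_indicator)
  qed
  ultimately show ?thesis
    using assms by simp
qed

text \<open>Continuity is known only on the two open half-lines, so \<open>u\<close> is split into
  its restrictions to them and its value at the single point \<open>\<xi>\<close>.\<close>

lemma admissible_measurable:
  assumes "admissible \<alpha> u \<xi>"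
  shows "u \<in> borel_measurable borel"
proof -
  have "(\<lambda>y. indicator {..<\<xi>} y *\<^sub>R u y + indicator {\<xi><..} y *\<^sub>R u y + indicator {\<xi>} y *\<^sub>R u \<xi>)
      \<in> borel_measurable borel"
    using assms unfolding admissible_def
    by (intro borel_measurable_add borel_measurable_continuous_on_indicator
        borel_measurable_scaleR borel_measurable_indicator) auto
  moreover have "(\<lambda>y. indicator {..<\<xi>} y *\<^sub>R u y + indicator {\<xi><..} y *\<^sub>R u y + indicator {\<xi>} y *\<^sub>R u \<xi>) = u"
    by (auto simp: fun_eq_iff split: split_indicator)
  ultimately show ?thesis
    by simp
qed

lemma admissible_abs_le:
  assumes "admissible \<alpha> u \<xi>"
  shows "\<bar>u y\<bar> \<le> 2 + \<bar>\<alpha> * (y - \<xi>)\<bar>"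
proof (cases "y \<le> \<xi>")
  case True
  then have "- 2 \<le> u y" "u y \<le> 0"
    using assms by (auto simp: admissible_def)
  then show ?thesis
    by linarith
next
  case False
  then have "0 \<le> u y" "u y \<le> \<alpha> * (y - \<xi>) + 2"
    using assms by (auto simp: admissible_def)
  then show ?thesis
    by linarith
qed

lemma integrable_kernel_g_admissible:
  assumes "\<epsilon> > 0" and "admissible \<alpha> u \<xi>"
  shows "integrable lborel (\<lambda>y. kernel_g \<epsilon> (x - y) * u y)"
proof (rule Bochner_Integration.integrable_bound)
  \<comment> \<open>The linear growth bound is split so that each summand is the absolute value of
    kernel times affine function, with coefficients (2, 0) and (0, \<alpha>).\<close>
  show "integrable lborel (\<lambda>y. \<bar>kernel_g \<epsilon> (x - y) * 2\<bar> + \<bar>kernel_g \<epsilon> (x - y) * (\<alpha> * (y - \<xi>))\<bar>)"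
    using has_bochner_integral_kernel_g_affine[OF assms(1), of x 2 0 \<xi>]
      has_bochner_integral_kernel_g_affine[OF assms(1), of x 0 \<alpha> \<xi>]
    by (intro Bochner_Integration.integrable_add integrable_abs) (auto simp: has_bochner_integral_iff)
  show "(\<lambda>y. kernel_g \<epsilon> (x - y) * u y) \<in> borel_measurable lborel"
    using admissible_measurable[OF assms(2)] by measurable
  show "AE y in lborel. norm (kernel_g \<epsilon> (x - y) * u y)
      \<le> norm (\<bar>kernel_g \<epsilon> (x - y) * 2\<bar> + \<bar>kernel_g \<epsilon> (x - y) * (\<alpha> * (y - \<xi>))\<bar>)"
  proof (rule AE_I2)
    fix y
    have "\<bar>kernel_g \<epsilon> (x - y)\<bar> * \<bar>u y\<bar> \<le> \<bar>kernel_g \<epsilon> (x - y)\<bar> * (2 + \<bar>\<alpha> * (y - \<xi>)\<bar>)"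
      by (intro mult_left_mono admissible_abs_le[OF assms(2)] abs_ge_zero)
    then show "norm (kernel_g \<epsilon> (x - y) * u y)
        \<le> norm (\<bar>kernel_g \<epsilon> (x - y) * 2\<bar> + \<bar>kernel_g \<epsilon> (x - y) * (\<alpha> * (y - \<xi>))\<bar>)"
      by (simp add: abs_mult distrib_left)
  qed
qed

text \<open>Here and below \<open>convolution\<close> is the constant of \<open>Defs\<close>, not the convolution of measures.\<close>

lemma convolution_at_interface_ge:
  assumes "\<epsilon> > 0" and "admissible \<alpha> u \<xi>"
  shows "- 1 \<le> convolution (kernel_g \<epsilon>) u \<xi>"
proof -
  have "has_bochner_integral lborel (\<lambda>y. - 2 * (kernel_g \<epsilon> (\<xi> - y) * indicator {..\<xi>} y)) (- 2 * (1 / 2))"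
    by (intro has_bochner_integral_mult_right has_bochner_integral_kernel_g_left_half assms)
  then have half: "integrable lborel (\<lambda>y. - 2 * (kernel_g \<epsilon> (\<xi> - y) * indicator {..\<xi>} y))"
      "(LINT y|lborel. - 2 * (kernel_g \<epsilon> (\<xi> - y) * indicator {..\<xi>} y)) = - 1"
    by (simp_all add: has_bochner_integral_iff)
  \<comment> \<open>Bound \<open>u\<close> below by -2 on the left of \<open>\<xi>\<close> and by 0
    on the right; half of the kernel's unit mass lies on the left, which gives -1.\<close>
  have "- 2 * (kernel_g \<epsilon> (\<xi> - y) * indicator {..\<xi>} y) \<le> kernel_g \<epsilon> (\<xi> - y) * u y" for y
  proof -
    have "- 2 * indicator {..\<xi>} y \<le> u y"
      using assms(2) by (auto simp: admissible_def split: split_indicator)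
    then have "kernel_g \<epsilon> (\<xi> - y) * (- 2 * indicator {..\<xi>} y) \<le> kernel_g \<epsilon> (\<xi> - y) * u y"
      by (intro mult_left_mono kernel_g_nonneg assms)
    then show ?thesis
      by (simp add: ac_simps)
  qed
  then show ?thesis
    unfolding convolution_def half(2)[symmetric]
    by (intro integral_mono half(1) integrable_kernel_g_admissible[OF assms])
qed

text \<open>The lower bound -1 at \<open>\<xi>\<close> rules out (RM). In case (LM) the smoothed
  function equals 1 at the new interface; in case (ST) the interface stays where the value is at
  most 1.\<close>

lemma interface_update_admissible:
  assumes "\<epsilon> > 0" and "admissible \<alpha> u \<xi>"
    and "interface_update (convolution (kernel_g \<epsilon>) u) \<xi> \<xi>'"
  shows "\<xi>' \<le> \<xi>" and "convolution (kernel_g \<epsilon>) u \<xi>' \<le> 1"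
  using convolution_at_interface_ge[OF assms(1,2)] assms(3)
  by (cases "convolution (kernel_g \<epsilon>) u \<xi> > 1"; simp add: interface_update_def)+

lemma kernel_g_shift_eq:
  assumes "y \<le> z" and "z \<le> x"
  shows "kernel_g \<epsilon> (x - y) = exp (- (x - z) / \<epsilon>) * kernel_g \<epsilon> (z - y)"
proof -
  have "- \<bar>x - y\<bar> / \<epsilon> = - (x - z) / \<epsilon> + - \<bar>z - y\<bar> / \<epsilon>"
    using assms by (simp add: add_divide_distrib[symmetric])
  then have "exp (- \<bar>x - y\<bar> / \<epsilon>) = exp (- (x - z) / \<epsilon>) * exp (- \<bar>z - y\<bar> / \<epsilon>)"
    by (simp only: exp_add)
  then show ?thesis
    by (simp add: kernel_g_def)
qed

text \<open>The triangle inequality \<bar>x - y\<bar> \<le> (x - z) + \<bar>z - y\<bar> in the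
  exponent.\<close>

lemma kernel_g_shift_le:
  assumes "\<epsilon> > 0" and "z \<le> x"
  shows "exp (- (x - z) / \<epsilon>) * kernel_g \<epsilon> (z - y) \<le> kernel_g \<epsilon> (x - y)"
proof -
  have "- (x - z) / \<epsilon> + - \<bar>z - y\<bar> / \<epsilon> \<le> - \<bar>x - y\<bar> / \<epsilon>"
    unfolding add_divide_distrib[symmetric] using assms by (intro divide_right_mono) auto
  then have "exp (- (x - z) / \<epsilon>) * exp (- \<bar>z - y\<bar> / \<epsilon>) \<le> exp (- \<bar>x - y\<bar> / \<epsilon>)"
    by (simp only: exp_add[symmetric] exp_le_cancel_iff)
  then have "1 / (2 * \<epsilon>) * (exp (- (x - z) / \<epsilon>) * exp (- \<bar>z - y\<bar> / \<epsilon>))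
      \<le> 1 / (2 * \<epsilon>) * exp (- \<bar>x - y\<bar> / \<epsilon>)"
    using assms by (intro mult_left_mono) auto
  then show ?thesis
    by (simp add: kernel_g_def ac_simps)
qed

text \<open>A comparison with the affine majorant \<open>?l\<close> that needs the bound only to the
  right of \<open>z\<close>: what lies to the left enters solely through the convolution at
  \<open>z\<close>. The right-hand side is sharp, with equality for u = \<open>?l\<close>, because
  the convolution of \<open>?l\<close> at \<open>z\<close> is \<open>a\<close>.\<close>

lemma convolution_kernel_g_le_affine:
  assumes "\<epsilon> > 0" and "z \<le> x"
    and int: "\<And>x. integrable lborel (\<lambda>y. kernel_g \<epsilon> (x - y) * u y)"
    and le: "\<And>y. y > z \<Longrightarrow> u y \<le> a + b * (y - z)"
  shows "convolution (kernel_g \<epsilon>) u x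
    \<le> a + b * (x - z) + exp (- (x - z) / \<epsilon>) * (convolution (kernel_g \<epsilon>) u z - a)"
proof -
  define E where "E = exp (- (x - z) / \<epsilon>)"
  let ?l = "\<lambda>y. a + b * (y - z)"
  have intl: "integrable lborel (\<lambda>y. kernel_g \<epsilon> (x - y) * ?l y)"
    and vall: "convolution (kernel_g \<epsilon>) ?l x = ?l x" for x
    using has_bochner_integral_kernel_g_affine[OF assms(1), of x a b z]
    by (simp_all add: has_bochner_integral_iff convolution_def)
  have "kernel_g \<epsilon> (x - y) * u y - E * (kernel_g \<epsilon> (z - y) * u y)
      \<le> kernel_g \<epsilon> (x - y) * ?l y - E * (kernel_g \<epsilon> (z - y) * ?l y)" for y
  proof (cases "y \<le> z")
    case True
    then show ?thesis
      using kernel_g_shift_eq[of y z x \<epsilon>] assms by (simp add: E_def)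
  next
    case False
    then have "(kernel_g \<epsilon> (x - y) - E * kernel_g \<epsilon> (z - y)) * u y
        \<le> (kernel_g \<epsilon> (x - y) - E * kernel_g \<epsilon> (z - y)) * ?l y"
      using kernel_g_shift_le[of \<epsilon> z x y] assms
      by (intro mult_left_mono le) (auto simp: E_def)
    then show ?thesis
      by (simp add: left_diff_distrib mult.assoc)
  qed
  then have "(LINT y|lborel. kernel_g \<epsilon> (x - y) * u y - E * (kernel_g \<epsilon> (z - y) * u y))
      \<le> (LINT y|lborel. kernel_g \<epsilon> (x - y) * ?l y - E * (kernel_g \<epsilon> (z - y) * ?l y))"
    by (intro integral_mono Bochner_Integration.integrable_diff integrable_mult_right int intl)
  then have "convolution (kernel_g \<epsilon>) u x - E * convolution (kernel_g \<epsilon>) u z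
      \<le> convolution (kernel_g \<epsilon>) ?l x - E * convolution (kernel_g \<epsilon>) ?l z"
    using int intl by (simp add: convolution_def)
  then show ?thesis
    unfolding vall E_def[symmetric] by (simp add: algebra_simps)
qed

theorem lemma4:
  fixes \<epsilon> \<alpha> \<xi> \<xi>' :: real and u u' :: "real \<Rightarrow> real"
  assumes "\<epsilon> > 0"
    and "admissible \<alpha> u \<xi>"
    and "scheme_step \<epsilon> (u, \<xi>) (u', \<xi>')"
  shows "\<forall>x>\<xi>'. u' x \<le> 2 + \<alpha> * (x - \<xi>')"
proof (intro allI impI)
  fix x assume "x > \<xi>'"
  define E where "E = exp (- (x - \<xi>') / \<epsilon>)"
  let ?v = "convolution (kernel_g \<epsilon>) u"
  have upd: "interface_update ?v \<xi> \<xi>'" and "u' = (\<lambda>x. ?v x + kernel_s \<epsilon> (x - \<xi>'))"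
    using assms(3) by (simp_all add: scheme_step_def Let_def)
  then have u': "u' x = ?v x + E"
    using \<open>x > \<xi>'\<close> by (simp add: kernel_s_def E_def)
  note \<xi>' = interface_update_admissible[OF assms(1,2) upd]
  \<comment> \<open>The majorant anchored at \<open>\<xi>\<close> is moved to \<open>\<xi>'\<close>:
    since \<xi>' \<le> \<xi> and \<alpha> > 0 it only grows, and on the gap between the two
    \<open>u\<close> is nonpositive.\<close>
  have "u y \<le> 2 + \<alpha> * (y - \<xi>')" if "y > \<xi>'" for y
  proof (cases "y \<le> \<xi>")
    case True
    then have "u y \<le> 0" "0 \<le> \<alpha> * (y - \<xi>')"
      using assms(2) that by (auto simp: admissible_def)
    then show ?thesis
      by simp
  next
    case False
    then have "u y \<le> \<alpha> * (y - \<xi>) + 2" "\<alpha> * (y - \<xi>) \<le> \<alpha> * (y - \<xi>')"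
      using assms(2) \<xi>'(1) by (auto simp: admissible_def)
    then show ?thesis
      by simp
  qed
  then have "?v x \<le> 2 + \<alpha> * (x - \<xi>') + E * (?v \<xi>' - 2)"
    unfolding E_def using \<open>x > \<xi>'\<close> assms
    by (intro convolution_kernel_g_le_affine integrable_kernel_g_admissible) auto
  \<comment> \<open>The resulting -E cancels exactly the +E that \<open>kernel_s\<close> contributes
    to \<open>u'\<close>.\<close>
  moreover have "E * (?v \<xi>' - 2) \<le> E * (- 1)"
    using \<xi>'(2) by (intro mult_left_mono) (auto simp: E_def)
  ultimately show "u' x \<le> 2 + \<alpha> * (x - \<xi>')"
    using u' by simp
qed

end
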